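(* Let $P$ be a finite atomic lattice and $\mathcal{M}=\{m_p\}$ a labeling of $P$ by monomials satisfying: (C1) if $p\in\mathrm{mi}(P)$ then $m_p\neq 1$; (C2) if $\gcd(m_p,m_q)\neq 1$ for some $p,q\in P$, then either $p$ and $q$ are comparable, or $r(p)=\dfrac{m_p}{\gcd(m_p,m_q)}\neq 1$ and $r(q)=\dfrac{m_q}{\gcd(m_p,m_q)}\neq 1$, and any two elements $x,y$ both lying in $\{s\in P\setminus\{q\}: \gcd(m_p,m_s)\neq 1\}$, or both lying in $\{s\in P\setminus\{p\}:\gcd(m_q,m_s)\neq1\}$, are comparable. Then $\mathcal{M}$ is a weak coordinatization of $P$.
   Context: A finite atomic lattice is a finite lattice $P$ with least element $0$ and greatest element in which every nonzero element is a join of atoms; $\mathrm{atoms}(P)$ is its set of atoms, and $\mathrm{supp}(p)=\{a\in\mathrm{atoms}(P): a\le p\}$. An element $x\in P$ is meet-irreducible if $x\neq a\wedge b$ for all $a>x$, $b>x$; $\mathrm{mi}(P)$ denotes the set of meet-irreducible elements. For $p\in P$, $\lceil p\rceil=\{q: q\ge p\}$ and $\lceil p\rceil^c=P\setminus\lceil p\rceil$. A labeling $\mathcal{M}$ of $P$ assigns a monomial $m_p$ (in a polynomial ring over a field) to each $p\in P$, unlabeled elements having label $1$. Conventions: $\mathrm{lcm}\,\emptyset=\gcd\emptyset=1$. For $a\in\mathrm{atoms}(P)$ let $x(a)=\prod_{p\in\lceil a\rceil^c}m_p$. For $p\in P$ let $B_p=\{T\subseteq\mathrm{supp}(p): \bigvee_{b\in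 T}b=p\}$, and for $a\in\mathrm{atoms}(P)$ let $\triangle(a)=\gcd\{\mathrm{lcm}\{x(b):b\in T\}: T\in\bigcup_{q\ge a}B_q\}$; $I_{P,\mathcal{M}}$ is the monomial ideal generated by all $\triangle(a)$. The lcm-lattice $LCM(I)$ of a monomial ideal $I$ is the set of least common multiples of subsets of its minimal generators, ordered by divisibility. $\mathcal{M}$ is a weak coordinatization of $P$ if there is a lattice isomorphism $g:P\to LCM(I_{P,\mathcal{M}})$ with $g(a)=\triangle(a)$ for every $a\in\mathrm{atoms}(P)$. *)

theory Defs
  imports Complex_Main "HOL-Library.Multiset" "HOL-Library.Poly_Mapping"
begin

section \<open>Finite atomic lattices\<close>

text \<open>A nonempty finite lattice is bounded and has all joins, so the carrier is a type of sort
  \<open>{finite, complete_lattice}\<close>; its least element is \<open>bot\<close> and \<open>\<Squnion>T\<close> is \<open>Sup T\<close>.\<close>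

definition atoms :: "'p::{finite, complete_lattice} set" where
  "atoms = {a. bot < a \<and> (\<forall>x. x < a \<longrightarrow> x = bot)}"

definition atomic_lattice :: "'p::{finite, complete_lattice} itself \<Rightarrow> bool" where
  "atomic_lattice _ \<longleftrightarrow> (\<forall>p::'p. p \<noteq> bot \<longrightarrow> (\<exists>T \<subseteq> atoms. p = Sup T))"

definition supp :: "'p::{finite, complete_lattice} \<Rightarrow> 'p set" where
  "supp p = {a \<in> atoms. a \<le> p}"

text \<open>The greatest element satisfies this condition vacuously.\<close>

definition meet_irreducibles :: "'p::{finite, complete_lattice} set" where
  "meet_irreducibles = {x. \<forall>a b. a > x \<longrightarrow> b > x \<longrightarrow> x \<noteq> inf a b}"

definition comparable :: "'p::order \<Rightarrow> 'p \<Rightarrow> bool" where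
  "comparable p q \<longleftrightarrow> p \<le> q \<or> q \<le> p"


section \<open>Monomials, polynomials and monomial ideals\<close>

text \<open>A monomial in the variables \<open>'v\<close> is the finite multiset of its variables: the multiset
  \<open>{#}\<close> is 1, \<open>+\<close> is multiplication, \<open>-\<close> is the quotient of a monomial by a divisor,
  \<open>\<subseteq>#\<close> is divisibility, \<open>\<inter>#\<close> is the gcd and \<open>\<union>#\<close> the lcm.
  On sets of monomials \<open>Inf\<close> is the gcd and \<open>Sup\<close> the lcm (for finite sets), both with
  value \<open>{#}\<close> on the empty set.

  The polynomial ring over \<open>'k\<close> is the monoid algebra of the monomials.\<close>

type_synonym 'v monomial = "'v multiset"
type_synonym ('v, 'k) polynomial = "'v multiset \<Rightarrow>\<^sub>0 'k"

lemma module_mult: "module ((*) :: 'a::comm_ring_1 \<Rightarrow> 'a \<Rightarrow> 'a)"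
  by unfold_locales (simp_all add: algebra_simps)

definition ideal_generated :: "'a::comm_ring_1 set \<Rightarrow> 'a set" where
  "ideal_generated = module.span (*)"

definition monom_ideal :: "'v monomial set \<Rightarrow> ('v, 'k::field) polynomial set" where
  "monom_ideal G = ideal_generated ((\<lambda>m. Poly_Mapping.single m 1) ` G)"

definition is_minimal_generating_set ::
    "('v, 'k::field) polynomial set \<Rightarrow> 'v monomial set \<Rightarrow> bool" where
  "is_minimal_generating_set I G \<longleftrightarrow>
     monom_ideal G = I \<and> (\<forall>H. H \<subset> G \<longrightarrow> monom_ideal H \<noteq> I)"

text \<open>A monomial ideal has exactly one minimal generating set consisting of monomials.\<close>

definition minimal_generators :: "('v, 'k::field) polynomial set \<Rightarrow> 'v monomial set" where
  "minimal_generators I = (THE G. is_minimal_generating_set I G)"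

definition LCM_lattice :: "('v, 'k::field) polynomial set \<Rightarrow> 'v monomial set" where
  "LCM_lattice I = {Sup A | A. A \<subseteq> minimal_generators I}"

definition is_join_in :: "'v monomial set \<Rightarrow> 'v monomial \<Rightarrow> 'v monomial \<Rightarrow> 'v monomial \<Rightarrow> bool" where
  "is_join_in L m n z \<longleftrightarrow> z \<in> L \<and> m \<subseteq># z \<and> n \<subseteq># z \<and>
     (\<forall>w\<in>L. m \<subseteq># w \<longrightarrow> n \<subseteq># w \<longrightarrow> z \<subseteq># w)"

definition is_meet_in :: "'v monomial set \<Rightarrow> 'v monomial \<Rightarrow> 'v monomial \<Rightarrow> 'v monomial \<Rightarrow> bool" where
  "is_meet_in L m n z \<longleftrightarrow> z \<in> L \<and> z \<subseteq># m \<and> z \<subseteq># n \<and>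
     (\<forall>w\<in>L. w \<subseteq># m \<longrightarrow> w \<subseteq># n \<longrightarrow> w \<subseteq># z)"

definition lattice_iso :: "('p::{finite, complete_lattice} \<Rightarrow> 'v monomial) \<Rightarrow> 'v monomial set \<Rightarrow> bool" where
  "lattice_iso g L \<longleftrightarrow> bij_betw g UNIV L \<and>
     (\<forall>p q. is_join_in L (g p) (g q) (g (sup p q))) \<and>
     (\<forall>p q. is_meet_in L (g p) (g q) (g (inf p q)))"


section \<open>Labelings and weak coordinatizations\<close>

definition atom_label :: "('p::{finite, complete_lattice} \<Rightarrow> 'v monomial) \<Rightarrow> 'p \<Rightarrow> 'v monomial" where
  "atom_label M a = (\<Sum>p \<in> - {a..}. M p)"

definition join_reps :: "'p::{finite, complete_lattice} \<Rightarrow> 'p set set" where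
  "join_reps p = {T. T \<subseteq> supp p \<and> Sup T = p}"

definition triangle :: "('p::{finite, complete_lattice} \<Rightarrow> 'v monomial) \<Rightarrow> 'p \<Rightarrow> 'v monomial" where
  "triangle M a = Inf ((\<lambda>T. Sup (atom_label M ` T)) ` (\<Union>q\<in>{a..}. join_reps q))"

definition labeling_ideal ::
    "('p::{finite, complete_lattice} \<Rightarrow> 'v monomial) \<Rightarrow> ('v, 'k::field) polynomial set" where
  "labeling_ideal M = monom_ideal (triangle M ` atoms)"

definition weak_coordinatization ::
    "'k::field itself \<Rightarrow> ('p::{finite, complete_lattice} \<Rightarrow> 'v monomial) \<Rightarrow> bool" where
  "weak_coordinatization _ M \<longleftrightarrow>
     (\<exists>g. lattice_iso g (LCM_lattice (labeling_ideal M :: ('v, 'k) polynomial set)) \<and>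
          (\<forall>a\<in>atoms. g a = triangle M a))"

end

theory Submission
  imports Defs
begin

text \<open>
  For a variable \<open>v\<close> and a bound \<open>k\<close>, let \<open>J v k\<close> be the join of the atoms \<open>b\<close> such that the
  exponent of \<open>v\<close> in \<open>x(b)\<close> is at most \<open>k\<close>. The definition of \<open>\<triangle>\<close> says exactly that the exponent
  of \<open>v\<close> in \<open>\<triangle>(a)\<close> is at most \<open>k\<close> iff \<open>a \<le> J v k\<close>. Hence \<open>g p = lcm {\<triangle>(a) | a \<in> supp p}\<close> has
  exponent at most \<open>k\<close> at \<open>v\<close> iff \<open>p \<le> J v k\<close>; such a map always preserves joins, and it is an order
  embedding as soon as every meet-irreducible element is some \<open>J v k\<close>. If \<open>m\<^sub>q \<noteq> 1\<close>, then (C2) yields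
  a variable whose exponent in \<open>m\<^sub>q\<close> exceeds the sum of its exponents in all labels of elements
  incomparable to \<open>q\<close>, and for such a variable \<open>q = J v k\<close> with a suitable \<open>k\<close>. Since \<open>g\<close> is an
  embedding, the \<open>\<triangle>(a)\<close> are pairwise incomparable under divisibility, so they are the minimal
  generators and the image of \<open>g\<close> is the lcm-lattice.
\<close>

section \<open>Exponents of gcds and lcms\<close>

lemma count_Sup_le_iff:
  assumes "finite A"
  shows "count (Sup A) v \<le> k \<longleftrightarrow> (\<forall>m\<in>A. count m v \<le> k)"
proof (cases "A = {}")
  case False
  have "count (Sup A) v = (SUP m\<in>A. count m v)"
    by (rule count_Sup_multiset_nonempty)
      (use False assms in \<open>auto intro: subset_mset.bdd_above_finite\<close>)
  then show ?thesis
    using False assms by (simp add: cSup_eq_Max)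
qed (simp add: Sup_multiset_empty)

lemma count_Inf_le_iff:
  assumes "finite A" "A \<noteq> {}"
  shows "count (Inf A) v \<le> k \<longleftrightarrow> (\<exists>m\<in>A. count m v \<le> k)"
proof -
  have "count (Inf A) v = (INF m\<in>A. count m v)"
    using assms by (simp add: count_Inf_multiset_nonempty)
  then show ?thesis
    using assms by (simp add: cInf_eq_Min Min_le_iff)
qed

text \<open>Exponents of gcds and lcms are handled only through their upper bounds \<open>k\<close>,
  so equality and divisibility of monomials are recovered from these bounds.\<close>

lemma multiset_eq_by_bounds:
  assumes "\<And>v k. count m v \<le> k \<longleftrightarrow> count n v \<le> k"
  shows "m = n"
  using assms by (metis multiset_eqI order_antisym order_refl)

lemma subseteq_mset_iff_bounds:
  "m \<subseteq># n \<longleftrightarrow> (\<forall>v k. count n v \<le> k \<longrightarrow> count m v \<le> k)"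
  unfolding subseteq_mset_def by (meson order_refl order_trans)

section \<open>Monomial ideals\<close>

text \<open>The polynomials all of whose monomials are divisible by some element of \<open>G\<close>
  form an ideal containing the generators, hence containing their span.\<close>

lemma monomials_of_monom_ideal:
  fixes f :: "('v, 'k::field) polynomial"
  assumes "f \<in> monom_ideal G" "m \<in> Poly_Mapping.keys f"
  shows "\<exists>n\<in>G. n \<subseteq># m"
proof -
  interpret module "(*) :: ('v, 'k) polynomial \<Rightarrow> _" by (rule module_mult)
  let ?S = "{f :: ('v, 'k) polynomial. \<forall>m\<in>Poly_Mapping.keys f. \<exists>n\<in>G. n \<subseteq># m}"
  have "subspace ?S"
  proof (rule subspaceI)
    show "0 \<in> ?S" by simp
    show "x + y \<in> ?S" if "x \<in> ?S" "y \<in> ?S" for x y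
      using that Poly_Mapping.keys_add[of x y] by blast
    show "c * x \<in> ?S" if "x \<in> ?S" for c x
    proof -
      have "\<exists>n\<in>G. n \<subseteq># m" if "m \<in> Poly_Mapping.keys (c * x)" for m
      proof -
        from that keys_mult[of c x] obtain a b
          where ab: "m = a + b" "b \<in> Poly_Mapping.keys x" by blast
        with \<open>x \<in> ?S\<close> obtain n where "n \<in> G" "n \<subseteq># b" by blast
        with ab show ?thesis
          by (metis mset_subset_eq_add_right subset_mset.order_trans)
      qed
      then show ?thesis by blast
    qed
  qed
  moreover have "(\<lambda>m. Poly_Mapping.single m 1) ` G \<subseteq> ?S" by auto
  ultimately have "monom_ideal G \<subseteq> ?S"
    unfolding monom_ideal_def ideal_generated_def by (rule span_minimal[rotated])
  with assms show ?thesis by blast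
qed

lemma single_in_monom_ideal:
  assumes "m \<in> G"
  shows "Poly_Mapping.single m 1 \<in> (monom_ideal G :: ('v, 'k::field) polynomial set)"
proof -
  interpret module "(*) :: ('v, 'k) polynomial \<Rightarrow> _" by (rule module_mult)
  show ?thesis
    unfolding monom_ideal_def ideal_generated_def using assms by (blast intro: span_base)
qed

lemma monom_ideal_eq_imp_divisor:
  assumes "monom_ideal G = (monom_ideal H :: ('v, 'k::field) polynomial set)" "m \<in> G"
  shows "\<exists>n\<in>H. n \<subseteq># m"
proof (rule monomials_of_monom_ideal)
  show "Poly_Mapping.single m 1 \<in> (monom_ideal H :: ('v, 'k) polynomial set)"
    using single_in_monom_ideal[OF assms(2)] assms(1) by blast
qed simp

lemma minimal_generators_antichain:
  fixes A :: "'v monomial set"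
  assumes antichain: "\<And>m n. m \<in> A \<Longrightarrow> n \<in> A \<Longrightarrow> m \<subseteq># n \<Longrightarrow> m = n"
  shows "minimal_generators (monom_ideal A :: ('v, 'k::field) polynomial set) = A"
  unfolding minimal_generators_def
proof (rule the_equality)
  let ?I = "monom_ideal A :: ('v, 'k) polynomial set"
  show "is_minimal_generating_set ?I A"
    unfolding is_minimal_generating_set_def
  proof (intro conjI allI impI notI)
    fix H assume "H \<subset> A" and H: "monom_ideal H = ?I"
    then obtain m where "m \<in> A" "m \<notin> H" by blast
    moreover obtain n where "n \<in> H" "n \<subseteq># m"
      using monom_ideal_eq_imp_divisor[OF H[symmetric] \<open>m \<in> A\<close>] by blast
    ultimately show False
      using antichain \<open>H \<subset> A\<close> by blast
  qed simp
  fix G assume "is_minimal_generating_set ?I G"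
  then have G: "monom_ideal G = ?I" and minimal: "\<And>H. H \<subset> G \<Longrightarrow> monom_ideal H \<noteq> ?I"
    unfolding is_minimal_generating_set_def by blast+
  have "A \<subseteq> G"
  proof
    fix a assume "a \<in> A"
    obtain n where n: "n \<in> G" "n \<subseteq># a"
      using monom_ideal_eq_imp_divisor[OF G[symmetric] \<open>a \<in> A\<close>] by blast
    obtain a' where a': "a' \<in> A" "a' \<subseteq># n"
      using monom_ideal_eq_imp_divisor[OF G \<open>n \<in> G\<close>] by blast
    \<comment> \<open>The chain \<open>a'\<close> divides \<open>n\<close> divides \<open>a\<close>
      collapses by the antichain property, so \<open>n = a\<close> lies in \<open>G\<close>.\<close>
    have "a' = a"
      using antichain a' \<open>a \<in> A\<close> n by (meson subset_mset.order_trans)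
    with a' n show "a \<in> G"
      by (metis subset_mset.order_antisym)
  qed
  with minimal show "G = A" by blast
qed

section \<open>Finite atomic lattices\<close>

lemma Sup_supp:
  fixes p :: "'p::{finite, complete_lattice}"
  assumes "atomic_lattice TYPE('p)"
  shows "Sup (supp p) = p"
proof (rule order_antisym)
  show "Sup (supp p) \<le> p" by (auto simp: supp_def intro: Sup_least)
  show "p \<le> Sup (supp p)"
  proof (cases "p = bot")
    case False
    with assms obtain T where "T \<subseteq> atoms" "p = Sup T"
      unfolding atomic_lattice_def by blast
    moreover from this have "T \<subseteq> supp p"
      by (auto simp: supp_def intro: Sup_upper)
    ultimately show ?thesis
      by (simp add: Sup_subset_mono)
  qed simp
qed

lemma supp_atom: "a \<in> atoms \<Longrightarrow> supp a = {a}"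
  unfolding supp_def atoms_def by (auto simp: order.order_iff_strict)

lemma atoms_antichain: "a \<in> atoms \<Longrightarrow> b \<in> atoms \<Longrightarrow> a \<le> b \<Longrightarrow> a = b"
  unfolding atoms_def by (auto simp: order.order_iff_strict)

text \<open>Choose \<open>r\<close> maximal among the elements above \<open>q\<close> but not above
  \<open>p\<close>. Everything strictly above \<open>r\<close> is then above \<open>p\<close>, and
  so is the meet of two such elements; hence that meet is not \<open>r\<close>.\<close>

lemma meet_irreducible_separates:
  fixes p q :: "'p::{finite, complete_lattice}"
  assumes "\<not> p \<le> q"
  obtains r where "r \<in> meet_irreducibles" "q \<le> r" "\<not> p \<le> r"
proof -
  have "finite {r. q \<le> r \<and> \<not> p \<le> r}" "q \<in> {r. q \<le> r \<and> \<not> p \<le> r}"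
    using assms by auto
  then obtain r where r: "q \<le> r" "\<not> p \<le> r"
    and max: "\<And>s. q \<le> s \<Longrightarrow> \<not> p \<le> s \<Longrightarrow> r \<le> s \<Longrightarrow> s = r"
    using finite_has_maximal2[of "{r. q \<le> r \<and> \<not> p \<le> r}" q] by blast
  have "p \<le> s" if "r < s" for s
    using max[of s] order.trans[of q r s] r(1) that by (auto simp: less_le)
  with r have "r \<in> meet_irreducibles"
    unfolding meet_irreducibles_def by (auto dest: le_infI)
  with r that show ?thesis by blast
qed

section \<open>The lcm-map of a labeling\<close>

definition level_join ::
    "('p::{finite, complete_lattice} \<Rightarrow> 'v monomial) \<Rightarrow> 'v \<Rightarrow> nat \<Rightarrow> 'p" where
  "level_join M v k = Sup {b \<in> atoms. count (atom_label M b) v \<le> k}"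

definition lcm_map ::
    "('p::{finite, complete_lattice} \<Rightarrow> 'v monomial) \<Rightarrow> 'p \<Rightarrow> 'v monomial" where
  "lcm_map M p = Sup (triangle M ` supp p)"

lemma count_triangle_le_iff:
  fixes M :: "'p::{finite, complete_lattice} \<Rightarrow> 'v monomial"
  assumes "a \<in> atoms"
  shows "count (triangle M a) v \<le> k \<longleftrightarrow> a \<le> level_join M v k"
proof -
  let ?R = "\<Union>q\<in>{a..}. join_reps q"
  have "{a} \<in> join_reps a"
    using assms by (simp add: join_reps_def supp_def)
  then have "?R \<noteq> {}" by auto
  then have iff: "count (triangle M a) v \<le> k \<longleftrightarrow>
      (\<exists>T\<in>?R. \<forall>b\<in>T. count (atom_label M b) v \<le> k)"
    unfolding triangle_def by (simp add: count_Inf_le_iff count_Sup_le_iff)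
  show ?thesis
  proof
    assume "count (triangle M a) v \<le> k"
    then obtain T where T: "T \<in> ?R" "\<forall>b\<in>T. count (atom_label M b) v \<le> k"
      unfolding iff by blast
    then have "a \<le> Sup T" "T \<subseteq> atoms" by (auto simp: join_reps_def supp_def)
    moreover from this T have "Sup T \<le> level_join M v k"
      unfolding level_join_def by (intro Sup_subset_mono) auto
    ultimately show "a \<le> level_join M v k" by simp
  next
    assume a: "a \<le> level_join M v k"
    \<comment> \<open>The set of all atoms within the bound is itself a representation of its join,
      so it serves as the witness.\<close>
    let ?T = "{b \<in> atoms. count (atom_label M b) v \<le> k}"
    have "?T \<in> join_reps (level_join M v k)"
      unfolding join_reps_def supp_def level_join_def by (auto intro: Sup_upper)
    with a have "?T \<in> ?R" by auto
    then show "count (triangle M a) v \<le> k"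
      unfolding iff by (rule bexI[rotated]) simp
  qed
qed

lemma count_Sup_triangle_le_iff:
  fixes M :: "'p::{finite, complete_lattice} \<Rightarrow> 'v monomial"
  assumes "T \<subseteq> atoms"
  shows "count (Sup (triangle M ` T)) v \<le> k \<longleftrightarrow> Sup T \<le> level_join M v k"
  using assms by (auto simp: count_Sup_le_iff count_triangle_le_iff Sup_le_iff subset_iff)

lemma count_lcm_map_le_iff:
  fixes M :: "'p::{finite, complete_lattice} \<Rightarrow> 'v monomial"
  assumes "atomic_lattice TYPE('p)"
  shows "count (lcm_map M p) v \<le> k \<longleftrightarrow> p \<le> level_join M v k"
  unfolding lcm_map_def
  by (subst count_Sup_triangle_le_iff) (auto simp: Sup_supp[OF assms], auto simp: supp_def)

text \<open>The lcm over a set of atoms depends only on their join; this puts every lcm of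
  generators into the range of \<open>lcm_map\<close>.\<close>

lemma lcm_map_Sup:
  fixes M :: "'p::{finite, complete_lattice} \<Rightarrow> 'v monomial"
  assumes "atomic_lattice TYPE('p)" "T \<subseteq> atoms"
  shows "lcm_map M (Sup T) = Sup (triangle M ` T)"
  by (rule multiset_eq_by_bounds)
    (simp add: count_lcm_map_le_iff[OF assms(1)] count_Sup_triangle_le_iff[OF assms(2)])

lemma lcm_map_atom: "a \<in> atoms \<Longrightarrow> lcm_map M a = triangle M a"
  by (simp add: lcm_map_def supp_atom)

lemma range_lcm_map:
  fixes M :: "'p::{finite, complete_lattice} \<Rightarrow> 'v monomial"
  assumes "atomic_lattice TYPE('p)"
  shows "range (lcm_map M) = {Sup A | A. A \<subseteq> triangle M ` atoms}"
proof (intro equalityI subsetI)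
  fix m assume "m \<in> range (lcm_map M)"
  then obtain p where "m = Sup (triangle M ` supp p)"
    unfolding lcm_map_def by blast
  moreover have "triangle M ` supp p \<subseteq> triangle M ` atoms" by (auto simp: supp_def)
  ultimately show "m \<in> {Sup A | A. A \<subseteq> triangle M ` atoms}" by blast
next
  fix m assume "m \<in> {Sup A | A. A \<subseteq> triangle M ` atoms}"
  then obtain T where "T \<subseteq> atoms" "m = Sup (triangle M ` T)"
    by (auto simp: subset_image_iff)
  with lcm_map_Sup[OF assms] show "m \<in> range (lcm_map M)" by (metis rangeI)
qed

lemma lcm_map_embedding:
  fixes M :: "'p::{finite, complete_lattice} \<Rightarrow> 'v monomial"
  assumes atomic: "atomic_lattice TYPE('p)"
    and levels: "\<And>r :: 'p. r \<in> meet_irreducibles \<Longrightarrow> \<exists>v k. r = level_join M v k"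
  shows "lcm_map M p \<subseteq># lcm_map M q \<longleftrightarrow> p \<le> q"
proof
  assume le: "lcm_map M p \<subseteq># lcm_map M q"
  show "p \<le> q"
  proof (rule ccontr)
    assume "\<not> p \<le> q"
    then obtain r where r: "r \<in> meet_irreducibles" "q \<le> r" "\<not> p \<le> r"
      by (rule meet_irreducible_separates)
    with levels obtain v k where "r = level_join M v k" by blast
    with le r show False
      by (simp add: subseteq_mset_iff_bounds count_lcm_map_le_iff[OF atomic])
  qed
qed (auto simp: subseteq_mset_iff_bounds count_lcm_map_le_iff[OF atomic])

text \<open>Joins and meets are taken in the divisibility order restricted to
  \<open>range g\<close>, so an order embedding transports them; a meet there need not be a
  gcd.\<close>

lemma lattice_iso_if_embedding:
  fixes g :: "'p::{finite, complete_lattice} \<Rightarrow> 'v monomial"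
  assumes "\<And>p q. g p \<subseteq># g q \<longleftrightarrow> p \<le> q"
  shows "lattice_iso g (range g)"
proof -
  have "inj g"
    using assms by (metis injI order_antisym subset_mset.order_refl)
  then show ?thesis
    unfolding lattice_iso_def is_join_in_def is_meet_in_def
    by (auto simp: assms bij_betw_def)
qed

lemma weak_coordinatization_if_levels:
  fixes M :: "'p::{finite, complete_lattice} \<Rightarrow> 'v monomial"
  assumes atomic: "atomic_lattice TYPE('p)"
    and levels: "\<And>r :: 'p. r \<in> meet_irreducibles \<Longrightarrow> \<exists>v k. r = level_join M v k"
  shows "weak_coordinatization TYPE('k::field) M"
proof -
  note embedding = lcm_map_embedding[OF atomic levels]
  have "minimal_generators (labeling_ideal M :: ('v, 'k) polynomial set) = triangle M ` atoms"
    unfolding labeling_ideal_def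
  proof (rule minimal_generators_antichain)
    fix m n assume "m \<in> triangle M ` atoms" "n \<in> triangle M ` atoms" "m \<subseteq># n"
    then obtain a b where ab: "a \<in> atoms" "b \<in> atoms" "m = lcm_map M a" "n = lcm_map M b"
      using lcm_map_atom[of _ M] by (metis imageE)
    with \<open>m \<subseteq># n\<close> have "a \<le> b" by (simp add: embedding)
    with ab show "m = n" using atoms_antichain by blast
  qed
  then have "LCM_lattice (labeling_ideal M :: ('v, 'k) polynomial set) = range (lcm_map M)"
    by (simp add: LCM_lattice_def range_lcm_map[OF atomic])
  then show ?thesis
    unfolding weak_coordinatization_def
    using lattice_iso_if_embedding[OF embedding] lcm_map_atom by metis
qed

section \<open>Labeled elements as level joins\<close>

text \<open>With \<open>k = ?B + ?N\<close>, the atoms within the bound are exactly those of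
  \<open>supp q\<close>, whose join is \<open>q\<close>.\<close>

lemma dominant_exponent_level_join:
  fixes M :: "'p::{finite, complete_lattice} \<Rightarrow> 'v monomial"
  assumes atomic: "atomic_lattice TYPE('p)"
    and dominant: "(\<Sum>s | \<not> comparable s q. count (M s) v) < count (M q) v"
  shows "\<exists>k. q = level_join M v k"
proof
  let ?B = "\<Sum>s | s < q. count (M s) v"
  let ?N = "\<Sum>s | \<not> comparable s q. count (M s) v"
  have "count (atom_label M b) v \<le> ?B + ?N \<longleftrightarrow> b \<le> q" for b
  proof
    assume le: "count (atom_label M b) v \<le> ?B + ?N"
    show "b \<le> q"
    proof (rule ccontr)
      assume "\<not> b \<le> q"
      \<comment> \<open>No label at or below \<open>q\<close> is omitted from \<open>x(b)\<close>,
        so the exponent is at least \<open>?B + count (M q) v\<close>, which exceeds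
        \<open>?B + ?N\<close>.\<close>
      then have "\<not> b \<le> s" if "s \<le> q" for s
        using that order.trans by blast
      then have "insert q {s. s < q} \<subseteq> - {b..}"
        by (auto simp: less_imp_le)
      then have "(\<Sum>s\<in>insert q {s. s < q}. count (M s) v) \<le> count (atom_label M b) v"
        unfolding atom_label_def count_sum by (intro sum_mono2) auto
      with le dominant show False by simp
    qed
  next
    assume "b \<le> q"
    \<comment> \<open>All labels at or above \<open>q\<close> drop out of \<open>x(b)\<close>; only
      those below or incomparable to \<open>q\<close> can remain.\<close>
    then have "b \<le> s" if "q \<le> s" for s
      using that order.trans by blast
    then have "- {b..} \<subseteq> {s. s < q} \<union> {s. \<not> comparable s q}"
      by (auto simp: comparable_def less_le)
    then have "count (atom_label M b) v \<le>
        (\<Sum>s\<in>{s. s < q} \<union> {s. \<not> comparable s q}. count (M s) v)"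
      unfolding atom_label_def count_sum by (intro sum_mono2) auto
    also have "\<dots> = ?B + ?N"
      by (rule sum.union_disjoint) (auto simp: comparable_def)
    finally show "count (atom_label M b) v \<le> ?B + ?N" .
  qed
  then show "q = level_join M v (?B + ?N)"
    unfolding level_join_def using Sup_supp[OF atomic, of q] by (simp add: supp_def)
qed

theorem theorem3p1:
  fixes M :: "'p::{finite, complete_lattice} \<Rightarrow> 'v monomial"
  assumes atomic: "atomic_lattice TYPE('p)"
    and C1: "\<And>p. p \<in> meet_irreducibles \<Longrightarrow> M p \<noteq> {#}"
    and C2: "\<And>p q. M p \<inter># M q \<noteq> {#} \<Longrightarrow>
       comparable p q \<or>
       (M p - (M p \<inter># M q) \<noteq> {#} \<and> M q - (M p \<inter># M q) \<noteq> {#} \<and>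
        (\<forall>x y. (x \<in> {s. s \<noteq> q \<and> M p \<inter># M s \<noteq> {#}} \<and> y \<in> {s. s \<noteq> q \<and> M p \<inter># M s \<noteq> {#}}) \<or>
               (x \<in> {s. s \<noteq> p \<and> M q \<inter># M s \<noteq> {#}} \<and> y \<in> {s. s \<noteq> p \<and> M q \<inter># M s \<noteq> {#}})
           \<longrightarrow> comparable x y))"
  shows "weak_coordinatization TYPE('k::field) M"
proof (rule weak_coordinatization_if_levels[OF atomic])
  fix q :: 'p assume "q \<in> meet_irreducibles"
  then have "M q \<noteq> {#}" by (rule C1)
  have "\<exists>v. (\<Sum>s | \<not> comparable s q. count (M s) v) < count (M q) v"
  proof (cases "\<exists>p. M q \<inter># M p \<noteq> {#} \<and> \<not> comparable q p")
    case True
    then obtain p where p: "M q \<inter># M p \<noteq> {#}" "\<not> comparable q p" by blast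
    from C2[OF p(1)] p(2) have quotient: "M q - (M q \<inter># M p) \<noteq> {#}"
      and chain: "\<And>x y. x \<noteq> p \<Longrightarrow> M q \<inter># M x \<noteq> {#} \<Longrightarrow>
        y \<noteq> p \<Longrightarrow> M q \<inter># M y \<noteq> {#} \<Longrightarrow> comparable x y"
      by simp_all
    \<comment> \<open>A variable of \<open>r(q)\<close> is one whose exponent in \<open>M q\<close>
      exceeds that in \<open>M p\<close>.\<close>
    from quotient obtain v where "v \<in># M q - (M q \<inter># M p)"
      by (rule multiset_nonemptyE)
    then have v: "count (M p) v < count (M q) v"
      by (simp flip: count_greater_zero_iff)
    \<comment> \<open>Otherwise \<open>s\<close> and \<open>q\<close> both lie among the elements
      other than \<open>p\<close> whose labels share a variable with \<open>M q\<close>, which (C2)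
      makes a chain. Thus only \<open>p\<close> contributes to the sum.\<close>
    have "count (M s) v = 0" if "\<not> comparable s q" "s \<noteq> p" for s
    proof (rule ccontr)
      assume "count (M s) v \<noteq> 0"
      with v have "v \<in># M q \<inter># M s"
        by (simp flip: count_greater_zero_iff)
      then have "M q \<inter># M s \<noteq> {#}" by (metis empty_not_add_mset multi_member_split)
      moreover have "q \<noteq> p" using p(2) by (auto simp: comparable_def)
      ultimately have "comparable s q"
        using chain[of s q] \<open>s \<noteq> p\<close> \<open>M q \<noteq> {#}\<close> by simp
      with that show False by simp
    qed
    moreover have "\<not> comparable p q" using p(2) by (auto simp: comparable_def)
    ultimately have "(\<Sum>s | \<not> comparable s q. count (M s) v) = (\<Sum>s\<in>{p}. count (M s) v)"
      by (intro sum.mono_neutral_right) auto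
    with v show ?thesis by (intro exI[of _ v]) simp
  next
    case False
    \<comment> \<open>Here any variable of \<open>M q\<close> works, since the sum over the
      incomparable elements vanishes.\<close>
    obtain v where v: "v \<in># M q" using \<open>M q \<noteq> {#}\<close> by (rule multiset_nonemptyE)
    have "count (M s) v = 0" if "\<not> comparable s q" for s
    proof (rule ccontr)
      assume "count (M s) v \<noteq> 0"
      with v have "v \<in># M q \<inter># M s"
        by (simp flip: count_greater_zero_iff)
      then have "M q \<inter># M s \<noteq> {#}" by (metis empty_not_add_mset multi_member_split)
      with False that show False by (auto simp: comparable_def)
    qed
    with v show ?thesis by (intro exI[of _ v]) simp
  qed
  then obtain v where "(\<Sum>s | \<not> comparable s q. count (M s) v) < count (M q) v" ..
  from dominant_exponent_level_join[OF atomic this] show "\<exists>v k. q = level_join M v k" ..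
qed

end
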